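(* There is a unique scaling-covariant homogeneous Gaussian-normalized functor $\mathcal{M}\colon\mathsf{Dim}_+\to\mathsf{RadMeas}$. Its values on objects are $$d\mathcal{M}(x)(u)=\frac{\pi^{x/2}}{\Gamma(x/2)}\,u^{x/2-1}\,du,\qquad x>0,$$ and its morphism part is given, for every $x>0$ and $r\ge 0$, by the morphism $\mathcal{M}(r)\colon\mathcal{M}(x)\to\mathcal{M}(x+2r)$ with density $$\mathcal{M}(r)(u)=R(x,r)\,u^r,\qquad R(x,r)=\pi^r\,\frac{\Gamma(x/2)}{\Gamma(x/2+r)}.$$
   Context: The category $\mathsf{Dim}_+$ (dimension-shift category) has as objects the positive real numbers $\mathbb{R}_{>0}$; there is exactly one morphism $x\to y$, denoted $r$, if $y=x+2r$ for some real $r\ge 0$, and no morphism $x\to y$ otherwise. Composition is addition of shift parameters: for $r\colon x\to x+2r$ and $s\colon x+2r\to x+2r+2s$, $s\circ r=r+s\colon x\to x+2(r+s)$. The identity at $x$ is $0\colon x\to x$. The category $\mathsf{RadMeas}$ has as objects the nonzero, locally finite positive Radon measures on $(0,\infty)$. A morphism $\mu\to\nu$ is a measurable function $h\colon(0,\infty)\to[0,\infty)$ with $d\nu=h\,d\mu$, i.e. $\nu(A)=\int_A h\,d\mu$ for every Borel $A\subset(0,\infty)$; two such functions $h,h'\colon\mu\to\nu$ are identified when $h=h'$ $\mu$-almost everywhere. Composition is pointwise multiplication of densities, and the identity is the constant function $1$. A functor $F\colon\mathsf{Dim}_+\to\mathsf{RadMeas}$ is called scaling-covariant homogeneous if both of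 the following hold. (SC) For every $x>0$, every $\phi\in C_c(\mathbb{R}_{>0})$ (continuous functions with compact support in $(0,\infty)$) and every $\lambda>0$, $$\int_0^\infty\phi(\lambda u)\,dF(x)(u)=\lambda^{-x/2}\int_0^\infty\phi(u)\,dF(x)(u).$$ (HD) There is a positive function $A\colon\{(x,r):x>0,\ r\ge 0\}\to(0,\infty)$ such that for every $x>0$ and $r\ge 0$ the morphism $F(r)\colon F(x)\to F(x+2r)$ is given by the density $h_{x,r}(u)=A(x,r)\,u^r$. A scaling-covariant homogeneous functor $F$ is called Gaussian-normalized if for every $x>0$ the function $u\mapsto e^{-u}$ is $F(x)$-integrable on $(0,\infty)$ and $$\int_0^\infty e^{-u}\,dF(x)(u)=\pi^{x/2}.$$ *)

theory Defs
  imports "HOL-Analysis.Analysis"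
begin

section \<open>Categories and functors\<close>

text \<open>
  Hom-sets are indexed by source and target, so an arrow need not carry its endpoints.
  \<open>Comp C x y z g f\<close> is \<open>g \<circ> f\<close> for \<open>f : x \<rightarrow> y\<close> and \<open>g : y \<rightarrow> z\<close>.
\<close>

record ('o, 'a) cat =
  Obj :: "'o set"
  Hom :: "'o \<Rightarrow> 'o \<Rightarrow> 'a set"
  Comp :: "'o \<Rightarrow> 'o \<Rightarrow> 'o \<Rightarrow> 'a \<Rightarrow> 'a \<Rightarrow> 'a"
  Ident :: "'o \<Rightarrow> 'a"

definition is_category :: "('o, 'a) cat \<Rightarrow> bool" where
  "is_category C \<longleftrightarrow>
     (\<forall>x\<in>Obj C. Ident C x \<in> Hom C x x) \<and>
     (\<forall>x\<in>Obj C. \<forall>y\<in>Obj C. \<forall>z\<in>Obj C. \<forall>f\<in>Hom C x y. \<forall>g\<in>Hom C y z.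
        Comp C x y z g f \<in> Hom C x z) \<and>
     (\<forall>x\<in>Obj C. \<forall>y\<in>Obj C. \<forall>f\<in>Hom C x y.
        Comp C x x y f (Ident C x) = f \<and> Comp C x y y (Ident C y) f = f) \<and>
     (\<forall>w\<in>Obj C. \<forall>x\<in>Obj C. \<forall>y\<in>Obj C. \<forall>z\<in>Obj C.
        \<forall>f\<in>Hom C w x. \<forall>g\<in>Hom C x y. \<forall>h\<in>Hom C y z.
        Comp C w y z h (Comp C w x y g f) = Comp C w x z (Comp C x y z h g) f)"

record ('o, 'a, 'p, 'b) cat_map =
  on_obj :: "'o \<Rightarrow> 'p"
  on_arr :: "'o \<Rightarrow> 'o \<Rightarrow> 'a \<Rightarrow> 'b"

text \<open>
  The last two clauses fix the values off the objects and arrows of \<open>C\<close>, so that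
  HOL equality of functors is equality of functors in the usual sense.
\<close>

definition is_functor ::
    "('o, 'a) cat \<Rightarrow> ('p, 'b) cat \<Rightarrow> ('o, 'a, 'p, 'b) cat_map \<Rightarrow> bool" where
  "is_functor C D F \<longleftrightarrow>
     is_category C \<and> is_category D \<and>
     (\<forall>x\<in>Obj C. on_obj F x \<in> Obj D) \<and>
     (\<forall>x\<in>Obj C. \<forall>y\<in>Obj C. \<forall>f\<in>Hom C x y.
        on_arr F x y f \<in> Hom D (on_obj F x) (on_obj F y)) \<and>
     (\<forall>x\<in>Obj C. on_arr F x x (Ident C x) = Ident D (on_obj F x)) \<and>
     (\<forall>x\<in>Obj C. \<forall>y\<in>Obj C. \<forall>z\<in>Obj C. \<forall>f\<in>Hom C x y. \<forall>g\<in>Hom C y z.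
        on_arr F x z (Comp C x y z g f) =
          Comp D (on_obj F x) (on_obj F y) (on_obj F z) (on_arr F y z g) (on_arr F x y f)) \<and>
     (\<forall>x. x \<notin> Obj C \<longrightarrow> on_obj F x = undefined) \<and>
     (\<forall>x y f. \<not> (x \<in> Obj C \<and> y \<in> Obj C \<and> f \<in> Hom C x y) \<longrightarrow> on_arr F x y f = undefined)"


section \<open>The dimension-shift category\<close>

definition Dim_plus :: "(real, real) cat" where
  "Dim_plus =
     \<lparr> Obj = {0<..},
       Hom = (\<lambda>x y. {r. 0 \<le> r \<and> y = x + 2 * r}),
       Comp = (\<lambda>x y z s r. r + s),
       Ident = (\<lambda>x. 0) \<rparr>"


section \<open>The category of Radon measures on the positive half-line\<close>

text \<open>Radon: a locally finite Borel measure that is inner regular with respect to compact sets.\<close>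

definition radon_pos :: "real measure \<Rightarrow> bool" where
  "radon_pos \<mu> \<longleftrightarrow>
     sets \<mu> = sets (restrict_space borel {0<..}) \<and>
     (\<forall>u>0. \<exists>U. open U \<and> u \<in> U \<and> U \<subseteq> {0<..} \<and> emeasure \<mu> U < \<infinity>) \<and>
     (\<forall>B\<in>sets \<mu>. emeasure \<mu> B = (SUP K\<in>{K. compact K \<and> K \<subseteq> B}. emeasure \<mu> K))"

text \<open>
  Functions on the half-line are represented by functions of type \<^typ>\<open>real \<Rightarrow> real\<close>
  whose values outside \<open>(0, \<infinity>)\<close>, the space of \<open>\<mu>\<close>, are irrelevant.
\<close>

definition densities :: "real measure \<Rightarrow> real measure \<Rightarrow> (real \<Rightarrow> real) set" where
  "densities \<mu> \<nu> =
     {h \<in> borel_measurable \<mu>. (\<forall>u>0. 0 \<le> h u) \<and> \<nu> = density \<mu> (\<lambda>u. ennreal (h u))}"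

definition ae_eq :: "real measure \<Rightarrow> real measure \<Rightarrow> ((real \<Rightarrow> real) \<times> (real \<Rightarrow> real)) set" where
  "ae_eq \<mu> \<nu> = {(h, h'). h \<in> densities \<mu> \<nu> \<and> h' \<in> densities \<mu> \<nu> \<and> (AE u in \<mu>. h u = h' u)}"

text \<open>The morphism \<open>\<mu> \<rightarrow> \<nu>\<close> represented by \<open>h\<close>; it is empty unless \<open>h \<in> densities \<mu> \<nu>\<close>.\<close>

definition dens_mor :: "real measure \<Rightarrow> real measure \<Rightarrow> (real \<Rightarrow> real) \<Rightarrow> (real \<Rightarrow> real) set" where
  "dens_mor \<mu> \<nu> h = ae_eq \<mu> \<nu> `` {h}"

definition RadMeas :: "(real measure, (real \<Rightarrow> real) set) cat" where
  "RadMeas =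
     \<lparr> Obj = {\<mu>. radon_pos \<mu> \<and> emeasure \<mu> {0<..} \<noteq> 0},
       Hom = (\<lambda>\<mu> \<nu>. densities \<mu> \<nu> // ae_eq \<mu> \<nu>),
       Comp = (\<lambda>\<mu> \<nu> \<rho> G F. \<Union>f\<in>F. \<Union>g\<in>G. dens_mor \<mu> \<rho> (\<lambda>u. g u * f u)),
       Ident = (\<lambda>\<mu>. dens_mor \<mu> \<mu> (\<lambda>_. 1)) \<rparr>"


section \<open>Scaling-covariant homogeneous functors\<close>

type_synonym dim_functor = "(real, real, real measure, (real \<Rightarrow> real) set) cat_map"

text \<open>\<open>C\<^sub>c(0, \<infinity>)\<close>; the support is the closure relative to \<open>(0, \<infinity>)\<close>.\<close>

definition Cc_pos :: "(real \<Rightarrow> real) set" where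
  "Cc_pos = {\<phi>. continuous_on {0<..} \<phi> \<and> compact ({0<..} \<inter> closure {u. 0 < u \<and> \<phi> u \<noteq> 0})}"

definition scaling_covariant :: "dim_functor \<Rightarrow> bool" where
  "scaling_covariant F \<longleftrightarrow>
     (\<forall>x>0. \<forall>\<phi>\<in>Cc_pos. \<forall>c>0.
        (\<integral>u. \<phi> (c * u) \<partial>on_obj F x) = c powr (- x / 2) * (\<integral>u. \<phi> u \<partial>on_obj F x))"

definition homogeneous_densities :: "dim_functor \<Rightarrow> bool" where
  "homogeneous_densities F \<longleftrightarrow>
     (\<exists>A :: real \<Rightarrow> real \<Rightarrow> real. \<forall>x>0. \<forall>r\<ge>0.
        0 < A x r \<and>
        on_arr F x (x + 2 * r) r =
          dens_mor (on_obj F x) (on_obj F (x + 2 * r)) (\<lambda>u. A x r * u powr r))"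

definition sc_homogeneous_functor :: "dim_functor \<Rightarrow> bool" where
  "sc_homogeneous_functor F \<longleftrightarrow>
     is_functor Dim_plus RadMeas F \<and> scaling_covariant F \<and> homogeneous_densities F"

definition gaussian_normalized :: "dim_functor \<Rightarrow> bool" where
  "gaussian_normalized F \<longleftrightarrow>
     (\<forall>x>0. integrable (on_obj F x) (\<lambda>u. exp (- u)) \<and>
             (\<integral>u. exp (- u) \<partial>on_obj F x) = pi powr (x / 2))"


section \<open>\<open>Dim_plus\<close> and \<open>RadMeas\<close> are categories\<close>

lemma is_category_Dim_plus: "is_category Dim_plus"
  by (auto simp: is_category_def Dim_plus_def)

lemma equiv_ae_eq: "equiv (densities \<mu> \<nu>) (ae_eq \<mu> \<nu>)"
proof (rule equivI)
  show "ae_eq \<mu> \<nu> \<subseteq> densities \<mu> \<nu> \<times> densities \<mu> \<nu>" by (auto simp: ae_eq_def)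
  show "refl_on (densities \<mu> \<nu>) (ae_eq \<mu> \<nu>)" by (auto simp: refl_on_def ae_eq_def)
  show "sym (ae_eq \<mu> \<nu>)" by (auto simp: sym_def ae_eq_def eq_commute)
  show "trans (ae_eq \<mu> \<nu>)"
  proof (rule transI)
    fix f g h assume fg: "(f, g) \<in> ae_eq \<mu> \<nu>" and gh: "(g, h) \<in> ae_eq \<mu> \<nu>"
    have "AE u in \<mu>. f u = g u" "AE u in \<mu>. g u = h u" using fg gh by (auto simp: ae_eq_def)
    then have "AE u in \<mu>. f u = h u" by eventually_elim simp
    then show "(f, h) \<in> ae_eq \<mu> \<nu>" using fg gh by (auto simp: ae_eq_def)
  qed
qed

lemma space_radon_pos: "radon_pos \<mu> \<Longrightarrow> space \<mu> = {0<..}"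
  using sets_eq_imp_space_eq[of \<mu> "restrict_space borel {0<..}"]
  by (auto simp: radon_pos_def space_restrict_space)

lemma densities_mult:
  assumes "radon_pos \<mu>" "f \<in> densities \<mu> \<nu>" "g \<in> densities \<nu> \<rho>"
  shows "(\<lambda>u. g u * f u) \<in> densities \<mu> \<rho>"
proof -
  have f: "f \<in> borel_measurable \<mu>" "\<And>u. 0 < u \<Longrightarrow> 0 \<le> f u"
    and nu: "\<nu> = density \<mu> (\<lambda>u. ennreal (f u))"
    using assms(2) by (auto simp: densities_def)
  have g: "g \<in> borel_measurable \<mu>" "\<And>u. 0 < u \<Longrightarrow> 0 \<le> g u"
    and rho: "\<rho> = density \<nu> (\<lambda>u. ennreal (g u))"
    using assms(3) by (auto simp: densities_def nu)
  have "\<rho> = density \<mu> (\<lambda>u. ennreal (f u) * ennreal (g u))"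
    unfolding rho nu using f g by (intro density_density_eq) auto
  also have "\<dots> = density \<mu> (\<lambda>u. ennreal (g u * f u))"
    using f g assms(1)
    by (intro density_cong) (auto simp: space_radon_pos ennreal_mult mult.commute)
  finally show ?thesis using f g by (auto simp: densities_def)
qed

lemma ae_eq_mult:
  assumes mu: "radon_pos \<mu>" and f: "(f, f') \<in> ae_eq \<mu> \<nu>" and g: "(g, g') \<in> ae_eq \<nu> \<rho>"
  shows "((\<lambda>u. g u * f u), (\<lambda>u. g' u * f' u)) \<in> ae_eq \<mu> \<rho>"
proof -
  have fD: "f \<in> borel_measurable \<mu>" "\<nu> = density \<mu> (\<lambda>u. ennreal (f u))" "\<And>u. 0 < u \<Longrightarrow> 0 \<le> f u"
    using f by (auto simp: ae_eq_def densities_def)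
  have "AE u in \<nu>. g u = g' u" using g by (auto simp: ae_eq_def)
  then have "AE u in \<mu>. 0 < ennreal (f u) \<longrightarrow> g u = g' u"
    unfolding fD(2) using fD(1) by (subst (asm) AE_density) auto
  moreover have "AE u in \<mu>. f u = f' u" using f by (auto simp: ae_eq_def)
  ultimately have "AE u in \<mu>. g u * f u = g' u * f' u"
    using AE_space
  proof eventually_elim
    case (elim u)
    have "0 \<le> f u" using elim fD(3)[of u] by (simp add: space_radon_pos[OF mu])
    then show ?case using elim by (cases "f u = 0") (auto simp: less_le)
  qed
  then show ?thesis
    using f g densities_mult[OF mu] by (auto simp: ae_eq_def)
qed

lemma Comp_dens_mor:
  assumes "radon_pos \<mu>" "f \<in> densities \<mu> \<nu>" "g \<in> densities \<nu> \<rho>"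
  shows "Comp RadMeas \<mu> \<nu> \<rho> (dens_mor \<nu> \<rho> g) (dens_mor \<mu> \<nu> f) = dens_mor \<mu> \<rho> (\<lambda>u. g u * f u)"
proof -
  have "dens_mor \<mu> \<rho> (\<lambda>u. g' u * f' u) = dens_mor \<mu> \<rho> (\<lambda>u. g u * f u)"
    if "f' \<in> dens_mor \<mu> \<nu> f" "g' \<in> dens_mor \<nu> \<rho> g" for f' g'
    using that ae_eq_mult[OF assms(1), of f f' \<nu> g g' \<rho>]
    unfolding dens_mor_def by (auto intro!: equiv_class_eq[OF equiv_ae_eq, symmetric])
  moreover have "f \<in> dens_mor \<mu> \<nu> f" "g \<in> dens_mor \<nu> \<rho> g"
    using assms equiv_class_self[OF equiv_ae_eq] by (auto simp: dens_mor_def)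
  ultimately have "(\<Union>f'\<in>dens_mor \<mu> \<nu> f. \<Union>g'\<in>dens_mor \<nu> \<rho> g. dens_mor \<mu> \<rho> (\<lambda>u. g' u * f' u))
      = dens_mor \<mu> \<rho> (\<lambda>u. g u * f u)"
    by blast
  then show ?thesis by (simp add: RadMeas_def)
qed

lemma Hom_RadMeas: "Hom RadMeas \<mu> \<nu> = dens_mor \<mu> \<nu> ` densities \<mu> \<nu>"
  by (auto simp: RadMeas_def quotient_def dens_mor_def)

lemma one_densities: "(\<lambda>_. 1) \<in> densities \<mu> \<mu>"
  by (auto simp: densities_def density_1)

lemma is_category_RadMeas: "is_category RadMeas"
proof -
  have obj: "radon_pos \<mu>" if "\<mu> \<in> Obj RadMeas" for \<mu> using that by (auto simp: RadMeas_def)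
  have id: "Ident RadMeas \<mu> = dens_mor \<mu> \<mu> (\<lambda>_. 1)" for \<mu> by (simp add: RadMeas_def)
  show ?thesis
    unfolding is_category_def Hom_RadMeas id
    by (auto simp: Comp_dens_mor obj one_densities densities_mult mult.assoc)
qed

end

theory Submission
  imports Defs
begin

text \<open>
  Since \<open>exp (- u)\<close> is integrable, the intervals \<open>(0, t)\<close> have finite measure, and dominated
  convergence carries scaling covariance from \<open>C\<^sub>c\<close> functions over to them:
  \<open>\<mu> (0, t) = t\<^sup>a \<mu> (0, 1)\<close>. As these intervals generate the Borel sets, any two measures
  that scale with the same exponent are proportional, and the Gaussian normalization makes
  them equal. The constant of a density \<open>A u\<^sup>r\<close> is then found by integrating \<open>exp (- u)\<close>
  against source and target.
\<close>

section \<open>Scaling covariance on the intervals from 0 to t\<close>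

text \<open>A Markov-type bound: on \<open>{0<..<t}\<close> the function
  \<open>exp t * exp (- u)\<close> is at least 1. Local finiteness on the half-line does not control
  the mass near 0; the integrability of \<open>exp (- u)\<close> does.\<close>

lemma integrable_exp_emeasure_Ioo_finite:
  fixes \<mu> :: "real measure"
  assumes sets: "sets \<mu> = sets (restrict_space borel {0<..})"
    and int: "integrable \<mu> (\<lambda>u. exp (- u))"
  shows "emeasure \<mu> {0<..<t} < \<infinity>"
proof -
  have meas: "{0<..<t} \<in> sets \<mu>"
    unfolding sets by (auto simp: sets_restrict_space_iff)
  have [measurable]: "(\<lambda>u. exp (- u)) \<in> borel_measurable \<mu>"
    using int by auto
  have "emeasure \<mu> {0<..<t} = (\<integral>\<^sup>+u. indicator {0<..<t} u \<partial>\<mu>)"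
    using meas by simp
  also have "\<dots> \<le> (\<integral>\<^sup>+u. ennreal (exp t) * ennreal (exp (- u)) \<partial>\<mu>)"
    by (intro nn_integral_mono)
       (auto simp: indicator_def ennreal_mult[symmetric] exp_add[symmetric])
  also have "\<dots> = ennreal (exp t) * (\<integral>\<^sup>+u. ennreal (exp (- u)) \<partial>\<mu>)"
    by (rule nn_integral_cmult) measurable
  also have "\<dots> < \<infinity>"
    using int by (simp add: nn_integral_eq_integral ennreal_mult_less_top)
  finally show ?thesis .
qed

text \<open>Trapezoids approximating the indicator of the open unit interval: zero up to
  \<open>1 / n\<close>, then rising and falling with slope \<open>n\<close>, cut off at height 1,
  and zero from 1 on.\<close>

definition bump :: "nat \<Rightarrow> real \<Rightarrow> real" where
  "bump n u = min 1 (max 0 (real n * min (u - 1 / real n) (1 - u)))"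

text \<open>The support stays at distance at least \<open>1 / Suc n\<close> from 0, so its closure
  in the reals already lies in the half-line and is compact there.\<close>

lemma bump_Cc_pos: "bump (Suc n) \<in> Cc_pos"
proof -
  have sub: "{u. 0 < u \<and> bump (Suc n) u \<noteq> 0} \<subseteq> {1 / real (Suc n)..1}"
  proof
    fix u assume "u \<in> {u. 0 < u \<and> bump (Suc n) u \<noteq> 0}"
    then have "max 0 (real (Suc n) * min (u - 1 / real (Suc n)) (1 - u)) \<noteq> 0"
      by (auto simp: bump_def)
    then have "real (Suc n) * min (u - 1 / real (Suc n)) (1 - u) > 0"
      by linarith
    then have "min (u - 1 / real (Suc n)) (1 - u) > 0"
      by (simp add: zero_less_mult_iff)
    then show "u \<in> {1 / real (Suc n)..1}" by auto
  qed
  then have cl: "closure {u. 0 < u \<and> bump (Suc n) u \<noteq> 0} \<subseteq> {1 / real (Suc n)..1}"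
    by (intro closure_minimal) auto
  moreover have "{1 / real (Suc n)..1} \<subseteq> {0<..}"
    by (auto intro: less_le_trans[rotated])
  ultimately have "{0<..} \<inter> closure {u. 0 < u \<and> bump (Suc n) u \<noteq> 0}
      = closure {u. 0 < u \<and> bump (Suc n) u \<noteq> 0}"
    by blast
  moreover have "compact (closure {u. 0 < u \<and> bump (Suc n) u \<noteq> 0})"
    using sub by (meson bounded_closed_interval bounded_subset compact_closure)
  ultimately show ?thesis
    unfolding Cc_pos_def by (auto simp: bump_def intro!: continuous_intros)
qed

lemma bump_bounds: "0 \<le> bump n u" "bump n u \<le> 1"
  by (auto simp: bump_def)

lemma bump_eq_0:
  assumes "1 \<le> u"
  shows "bump n u = 0"
proof -
  have "real n * min (u - 1 / real n) (1 - u) \<le> 0"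
    using assms by (intro mult_nonneg_nonpos) auto
  then show ?thesis by (simp add: bump_def)
qed

lemma bump_tendsto:
  assumes "0 < u"
  shows "(\<lambda>n. bump (Suc n) u) \<longlonglongrightarrow> indicator {0<..<1} u"
proof (cases "u < 1")
  case True
  \<comment> \<open>Once \<open>1 / Suc n < d\<close>, the bound \<open>d \<le> u / 2\<close> leaves
    a distance of at least \<open>d\<close> from \<open>u\<close> down to \<open>1 / Suc n\<close>,
    and \<open>d \<le> 1 - u\<close> does the same on the right. Then \<open>Suc n * d > 1\<close>,
    so the cut-off at 1 takes effect.\<close>
  define d where "d = min (u / 2) (1 - u)"
  have d: "0 < d" using True assms by (simp add: d_def)
  obtain N where N: "1 / d < real N" using reals_Archimedean2 by blast
  have "bump (Suc n) u = 1" if "n \<ge> N" for n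
  proof -
    have *: "1 / d < real (Suc n)" using N that by simp
    have dn: "1 < real (Suc n) * d" using * d by (simp add: field_simps)
    have "1 / real (Suc n) < d" using dn by (simp add: field_simps)
    then have "d \<le> min (u - 1 / real (Suc n)) (1 - u)"
      using d_def by linarith
    then have "real (Suc n) * d \<le> real (Suc n) * min (u - 1 / real (Suc n)) (1 - u)"
      by (intro mult_left_mono) auto
    then show ?thesis using dn unfolding bump_def by linarith
  qed
  then have "eventually (\<lambda>n. bump (Suc n) u = 1) sequentially"
    by (auto simp: eventually_sequentially)
  then show ?thesis using True assms by (simp add: tendsto_eventually)
next
  case False
  then show ?thesis by (simp add: bump_eq_0)
qed

text \<open>The covariance identity holds for each bump and passes to the limit by dominated
  convergence. The dominating function is the indicator of the limiting interval, integrable because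
  that interval has finite mass.\<close>

lemma scaling_Ioo:
  fixes \<mu> :: "real measure"
  assumes sets: "sets \<mu> = sets (restrict_space borel {0<..})"
    and int: "integrable \<mu> (\<lambda>u. exp (- u))"
    and sc: "\<And>\<phi> c. \<phi> \<in> Cc_pos \<Longrightarrow> 0 < c \<Longrightarrow>
      (\<integral>u. \<phi> (c * u) \<partial>\<mu>) = c powr (- a) * (\<integral>u. \<phi> u \<partial>\<mu>)"
    and t: "0 < t"
  shows "measure \<mu> {0<..<t} = t powr a * measure \<mu> {0<..<1}"
proof -
  have space: "space \<mu> = {0<..}"
    using sets_eq_imp_space_eq[OF sets] by (simp add: space_restrict_space)
  \<comment> \<open>A general \<open>c\<close> serves both sides of the identity:
    \<open>c = 1 / t\<close> yields the interval up to \<open>t\<close>, and \<open>c = 1\<close>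
    the unit interval.\<close>
  have lim: "(\<lambda>n. \<integral>u. bump (Suc n) (c * u) \<partial>\<mu>) \<longlonglongrightarrow> measure \<mu> {0<..<1 / c}" if c: "0 < c" for c
  proof -
    have meas: "{0<..<1 / c} \<in> sets \<mu>"
      unfolding sets by (auto simp: sets_restrict_space_iff)
    have "(\<lambda>n. \<integral>u. bump (Suc n) (c * u) \<partial>\<mu>) \<longlonglongrightarrow> (\<integral>u. indicator {0<..<1 / c} u \<partial>\<mu>)"
    proof (rule integral_dominated_convergence)
      show "integrable \<mu> (\<lambda>u. indicator {0<..<1 / c} u :: real)"
        using meas integrable_exp_emeasure_Ioo_finite[OF sets int] by simp
      show "(\<lambda>u. indicator {0<..<1 / c} u) \<in> borel_measurable \<mu>"
        using meas by simp
      show "(\<lambda>u. bump (Suc n) (c * u)) \<in> borel_measurable \<mu>" for n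
        unfolding measurable_cong_sets[OF sets refl] bump_def
        by (intro measurable_restrict_space1) measurable
      show "AE u in \<mu>. (\<lambda>n. bump (Suc n) (c * u)) \<longlonglongrightarrow> indicator {0<..<1 / c} u"
      proof (rule AE_I2)
        fix u assume "u \<in> space \<mu>"
        then have u: "0 < u" by (simp add: space)
        have "indicator {0<..<1 / c} u = (indicator {0<..<1} (c * u) :: real)"
          using c u by (auto simp: indicator_def field_simps)
        then show "(\<lambda>n. bump (Suc n) (c * u)) \<longlonglongrightarrow> indicator {0<..<1 / c} u"
          using bump_tendsto[of "c * u"] c u by simp
      qed
      show "AE u in \<mu>. norm (bump (Suc n) (c * u)) \<le> indicator {0<..<1 / c} u" for n
      proof (rule AE_I2)
        fix u assume "u \<in> space \<mu>"
        then have u: "0 < u" by (simp add: space)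
        show "norm (bump (Suc n) (c * u)) \<le> indicator {0<..<1 / c} u"
          using c u bump_bounds[of "Suc n" "c * u"] bump_eq_0[of "c * u" "Suc n"]
          by (auto simp: indicator_def field_simps)
      qed
    qed
    then show ?thesis using meas space by (simp add: Int_absorb2 subset_eq)
  qed
  have "(\<lambda>n. \<integral>u. bump (Suc n) (1 / t * u) \<partial>\<mu>) \<longlonglongrightarrow> measure \<mu> {0<..<t}"
    using lim[of "1 / t"] t by simp
  moreover have "(\<lambda>n. \<integral>u. bump (Suc n) (1 / t * u) \<partial>\<mu>)
      = (\<lambda>n. t powr a * (\<integral>u. bump (Suc n) (1 * u) \<partial>\<mu>))"
    using sc[OF bump_Cc_pos, of "1 / t"] t by (simp add: powr_minus powr_divide)
  moreover have "(\<lambda>n. t powr a * (\<integral>u. bump (Suc n) (1 * u) \<partial>\<mu>))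
      \<longlonglongrightarrow> t powr a * measure \<mu> {0<..<1 / 1}"
    by (intro tendsto_mult_left lim) simp
  ultimately show ?thesis by (auto intro: LIMSEQ_unique)
qed

section \<open>Intervals as a determining class, and uniqueness up to a factor\<close>

text \<open>Taking traces commutes with generating a sigma-algebra, and the rays
  \<open>{..<t}\<close> generate the Borel sets of the line. For \<open>t \<le> 0\<close> the trace
  is empty, so positive \<open>t\<close> suffice.\<close>

lemma sets_borel_pos_eq_sigma_sets:
  "sets (restrict_space borel {0<..}) = sigma_sets {0<..} {{0<..<t} | t :: real. 0 < t}"
    (is "_ = sigma_sets _ ?E")
proof -
  have "sets (borel :: real measure) = sigma_sets UNIV (range lessThan)"
    unfolding borel_eq_lessThan by (simp add: lessThan_def eucl_less_def)
  then have "sets (restrict_space borel {0<..}) = (\<inter>) {0<..} ` sigma_sets UNIV (range lessThan :: real set set)"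
    by (simp add: sets_restrict_space)
  also have "\<dots> = sigma_sets {0<..} ((\<inter>) {0<..} ` range lessThan :: real set set)"
    by (rule sigma_sets_Int) (simp_all add: \<open>sets borel = _\<close>[symmetric])
  also have "\<dots> = sigma_sets {0<..} ?E"
  proof (rule sigma_sets_eqI)
    fix A :: "real set" assume "A \<in> (\<inter>) {0<..} ` range lessThan"
    then obtain t where A: "A = {0<..<t}" by (auto simp: greaterThanLessThan_def)
    show "A \<in> sigma_sets {0<..} ?E"
    proof (cases "0 < t")
      case True
      then show ?thesis using A by (auto intro: sigma_sets.Basic)
    next
      case False
      then have "A = {}" using A by simp
      then show ?thesis by (simp add: sigma_sets.Empty)
    qed
  qed (auto intro!: sigma_sets.Basic simp: greaterThanLessThan_def)
  finally show ?thesis .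
qed

text \<open>The intervals form a generator stable under intersection, and countably many of them,
  all of finite mass, exhaust the half-line.\<close>

lemma measure_eqI_Ioo:
  fixes \<mu> \<nu> :: "real measure"
  assumes "sets \<mu> = sets (restrict_space borel {0<..})"
    and "sets \<nu> = sets (restrict_space borel {0<..})"
    and "\<And>t. 0 < t \<Longrightarrow> emeasure \<mu> {0<..<t} < \<infinity>"
    and "\<And>t. 0 < t \<Longrightarrow> emeasure \<mu> {0<..<t} = emeasure \<nu> {0<..<t}"
  shows "\<mu> = \<nu>"
proof (rule measure_eqI_generator_eq)
  let ?E = "{{0<..<t} | t :: real. 0 < t}"
  show "Int_stable ?E"
  proof (rule Int_stableI)
    fix A B assume "A \<in> ?E" "B \<in> ?E"
    then obtain s t where "A = {0<..<s}" "B = {0<..<t}" "0 < s" "0 < t" by auto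
    then have "A \<inter> B = {0<..<min s t}" "0 < min s t" by auto
    then show "A \<inter> B \<in> ?E" by blast
  qed
  show "sets \<mu> = sigma_sets {0<..} ?E" "sets \<nu> = sigma_sets {0<..} ?E"
    using assms sets_borel_pos_eq_sigma_sets by simp_all
  \<comment> \<open>The index \<open>Suc n\<close> keeps the endpoint positive, as membership in
    \<open>?E\<close> requires.\<close>
  show "range (\<lambda>n. {0<..<real (Suc n)}) \<subseteq> ?E" by fastforce
  show "(\<Union>n. {0<..<real (Suc n)}) = {0<..}"
  proof safe
    fix u :: real assume "0 < u"
    obtain n where "u < real n" using reals_Archimedean2 by blast
    then show "u \<in> (\<Union>n. {0<..<real (Suc n)})" using \<open>0 < u\<close> by (auto intro!: exI[of _ n])
  qed auto
  show "emeasure \<mu> {0<..<real (Suc n)} \<noteq> \<infinity>" for n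
    using assms(3)[of "real (Suc n)"] by simp
qed (use assms(4) in auto)

lemma scaling_measure_unique:
  fixes \<mu> \<nu> :: "real measure"
  assumes sets: "sets \<mu> = sets (restrict_space borel {0<..})"
      "sets \<nu> = sets (restrict_space borel {0<..})"
    and int: "integrable \<mu> (\<lambda>u. exp (- u))" "integrable \<nu> (\<lambda>u. exp (- u))"
    and sc: "\<And>\<phi> c. \<phi> \<in> Cc_pos \<Longrightarrow> 0 < c \<Longrightarrow>
        (\<integral>u. \<phi> (c * u) \<partial>\<mu>) = c powr (- a) * (\<integral>u. \<phi> u \<partial>\<mu>)"
      "\<And>\<phi> c. \<phi> \<in> Cc_pos \<Longrightarrow> 0 < c \<Longrightarrow>
        (\<integral>u. \<phi> (c * u) \<partial>\<nu>) = c powr (- a) * (\<integral>u. \<phi> u \<partial>\<nu>)"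
    and eq: "(\<integral>u. exp (- u) \<partial>\<mu>) = (\<integral>u. exp (- u) \<partial>\<nu>)" and nz: "(\<integral>u. exp (- u) \<partial>\<nu>) \<noteq> 0"
  shows "\<mu> = \<nu>"
proof -
  define k where "k = measure \<mu> {0<..<1}"
  define l where "l = measure \<nu> {0<..<1}"
  have fin: "emeasure \<mu> {0<..<t} < \<infinity>" "emeasure \<nu> {0<..<t} < \<infinity>" for t
    using integrable_exp_emeasure_Ioo_finite sets int by auto
  have mu: "emeasure \<mu> {0<..<t} = ennreal (t powr a * k)" if "0 < t" for t
    using scaling_Ioo[OF sets(1) int(1) sc(1) that] fin
    by (simp add: emeasure_eq_ennreal_measure k_def less_top[symmetric])
  have nu: "emeasure \<nu> {0<..<t} = ennreal (t powr a * l)" if "0 < t" for t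
    using scaling_Ioo[OF sets(2) int(2) sc(2) that] fin
    by (simp add: emeasure_eq_ennreal_measure l_def less_top[symmetric])
  have kl: "0 \<le> k" "0 \<le> l" by (auto simp: k_def l_def)
  have Ioo: "{0<..<t} \<in> sets \<mu>" "{0<..<t} \<in> sets \<nu>" for t
    unfolding sets by (auto simp: sets_restrict_space_iff)
  \<comment> \<open>Cross-weighting, \<mu> by \<open>l\<close> and \<nu> by \<open>k\<close>,
    expresses proportionality without a division, so \<open>k\<close> and \<open>l\<close> may still
    be zero at this point.\<close>
  have dens: "emeasure (density \<mu> (\<lambda>_. ennreal l)) {0<..<t} = ennreal (t powr a * k * l)"
    "emeasure (density \<nu> (\<lambda>_. ennreal k)) {0<..<t} = ennreal (t powr a * k * l)" if "0 < t" for t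
    using that kl Ioo
    by (auto simp: emeasure_density_const mu nu ennreal_mult[symmetric] mult_ac)
  have proportional: "density \<mu> (\<lambda>_. ennreal l) = density \<nu> (\<lambda>_. ennreal k)"
    by (rule measure_eqI_Ioo) (simp_all add: sets dens)
  have "(\<integral>u. exp (- u) \<partial>density \<mu> (\<lambda>_. ennreal l)) = l * (\<integral>u. exp (- u) \<partial>\<mu>)"
    using kl int by (subst integral_density) auto
  moreover have "(\<integral>u. exp (- u) \<partial>density \<nu> (\<lambda>_. ennreal k)) = k * (\<integral>u. exp (- u) \<partial>\<nu>)"
    using kl int by (subst integral_density) auto
  \<comment> \<open>Both Gaussian integrals share one nonzero value, which cancels from the two
    evaluations of the same weighted measure.\<close>
  ultimately have "k = l" using proportional eq nz by simp
  then show ?thesis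
    by (intro measure_eqI_Ioo) (simp_all add: sets mu nu)
qed

section \<open>Inner regularity on the half-line\<close>

text \<open>\<open>inner_regular\<close> concerns finite Borel measures on a whole Polish space. It
  is applied to the part of \<mu> on \<open>{0<..<t}\<close>, viewed as a measure on the line;
  letting \<open>t\<close> grow through the naturals then exhausts \<open>B\<close>. This makes the
  candidate measures Radon.\<close>

lemma inner_regular_pos:
  fixes \<mu> :: "real measure"
  assumes sets: "sets \<mu> = sets (restrict_space borel {0<..})"
    and fin: "\<And>t. emeasure \<mu> {0<..<t} < \<infinity>"
    and B: "B \<in> sets \<mu>"
  shows "emeasure \<mu> B = (SUP K\<in>{K. compact K \<and> K \<subseteq> B}. emeasure \<mu> K)"
proof (rule antisym)
  have space: "space \<mu> = {0<..}"
    using sets_eq_imp_space_eq[OF sets] by (simp add: space_restrict_space)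
  have B': "B \<in> sets borel" "B \<subseteq> {0<..}"
    using B unfolding sets by (auto simp: sets_restrict_space_iff)
  have Int: "A \<inter> {0<..<t} \<in> sets \<mu>" if "A \<in> sets borel" for A t
    using that unfolding sets by (auto simp: sets_restrict_space_iff)
  have le: "emeasure \<mu> (B \<inter> {0<..<t}) \<le> (SUP K\<in>{K. compact K \<and> K \<subseteq> B}. emeasure \<mu> K)" for t
  proof -
    \<comment> \<open>Pushing forward along the identity only replaces the trace sigma-algebra by
      \<open>borel\<close> on all of the reals.\<close>
    define N where "N = distr (restrict_space \<mu> {0<..<t}) borel (\<lambda>u. u)"
    have Ioo: "{0<..<t} \<inter> space \<mu> \<in> sets \<mu>"
      using Int[of UNIV t] by (intro sets.Int sets.top) simp
    have id: "(\<lambda>u. u) \<in> restrict_space \<mu> {0<..<t} \<rightarrow>\<^sub>M borel"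
      by (rule measurable_restrict_space1)
         (unfold measurable_cong_sets[OF sets refl], rule measurable_restrict_space1, simp)
    have N: "emeasure N A = emeasure \<mu> (A \<inter> {0<..<t})" if "A \<in> sets borel" for A
    proof -
      have "A \<inter> space (restrict_space \<mu> {0<..<t}) = A \<inter> {0<..<t}"
        by (auto simp: space_restrict_space space)
      then have "emeasure N A = emeasure (restrict_space \<mu> {0<..<t}) (A \<inter> {0<..<t})"
        unfolding N_def by (subst emeasure_distr[OF id that]) simp
      also have "\<dots> = emeasure \<mu> (A \<inter> {0<..<t})"
        by (rule emeasure_restrict_space[OF Ioo]) simp
      finally show ?thesis .
    qed
    have "emeasure \<mu> (B \<inter> {0<..<t}) = emeasure N (B \<inter> {0<..<t})"
      using N[of "B \<inter> {0<..<t}"] B'(1) by (simp add: Int_assoc)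
    also have "\<dots> = (SUP K\<in>{K. K \<subseteq> B \<inter> {0<..<t} \<and> compact K}. emeasure N K)"
    proof (rule inner_regular)
      show sets_N: "sets N = sets borel" by (simp add: N_def)
      have "emeasure N (space N) = emeasure \<mu> {0<..<t}"
        using N[of UNIV] sets_eq_imp_space_eq[OF sets_N] by simp
      then show "emeasure N (space N) \<noteq> \<infinity>" using fin[of t] by simp
      show "B \<inter> {0<..<t} \<in> sets borel" using B' by simp
    qed
    also have "\<dots> \<le> (SUP K\<in>{K. compact K \<and> K \<subseteq> B}. emeasure \<mu> K)"
    proof (rule SUP_mono)
      fix K assume "K \<in> {K. K \<subseteq> B \<inter> {0<..<t} \<and> compact K}"
      then have K: "compact K" "K \<subseteq> B" "K \<inter> {0<..<t} = K" by auto
      then show "\<exists>L\<in>{K. compact K \<and> K \<subseteq> B}. emeasure N K \<le> emeasure \<mu> L"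
        using N[OF borel_compact[OF K(1)]] by (intro bexI[of _ K]) simp_all
    qed
    finally show ?thesis .
  qed
  have "(\<Union>n. B \<inter> {0<..<real n}) = B"
  proof
    show "B \<subseteq> (\<Union>n. B \<inter> {0<..<real n})"
    proof
      fix u assume u: "u \<in> B"
      obtain n where "u < real n" using reals_Archimedean2 by blast
      then have "u \<in> B \<inter> {0<..<real n}" using u B'(2) by auto
      then show "u \<in> (\<Union>n. B \<inter> {0<..<real n})" by blast
    qed
  qed blast
  moreover have "incseq (\<lambda>n. B \<inter> {0<..<real n})"
    unfolding incseq_def by (auto intro: less_le_trans)
  ultimately have "emeasure \<mu> B = (SUP n. emeasure \<mu> (B \<inter> {0<..<real n}))"
    using SUP_emeasure_incseq[of "\<lambda>n. B \<inter> {0<..<real n}" \<mu>] Int[OF B'(1)]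
    by (simp add: image_subset_iff)
  also have "\<dots> \<le> (SUP K\<in>{K. compact K \<and> K \<subseteq> B}. emeasure \<mu> K)"
    by (intro SUP_least le)
  finally show "emeasure \<mu> B \<le> (SUP K\<in>{K. compact K \<and> K \<subseteq> B}. emeasure \<mu> K)" .
next
  show "(SUP K\<in>{K. compact K \<and> K \<subseteq> B}. emeasure \<mu> K) \<le> emeasure \<mu> B"
    using B by (intro SUP_least emeasure_mono) simp_all
qed

section \<open>The candidate measures and their Gamma integrals\<close>

lemma has_bochner_integral_Gamma:
  assumes "0 < (a :: real)"
  shows "has_bochner_integral (restrict_space lborel {0<..}) (\<lambda>u. u powr (a - 1) * exp (- u)) (Gamma a)"
proof (rule has_bochner_integral_nn_integral)
  show "(\<lambda>u. u powr (a - 1) * exp (- u)) \<in> borel_measurable (restrict_space lborel {0<..})"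
    by (intro measurable_restrict_space1) measurable
  have "(\<integral>\<^sup>+u. ennreal (u powr (a - 1) * exp (- u)) \<partial>restrict_space lborel {0<..})
      = (\<integral>\<^sup>+u. ennreal (u powr (a - 1) * exp (- u)) * indicator {0<..} u \<partial>lborel)"
    by (simp add: nn_integral_restrict_space)
  \<comment> \<open>The two integrands agree even at \<open>u = 0\<close>, since
    \<open>0 powr b = 0\<close> for every \<open>b\<close>.\<close>
  also have "\<dots> = (\<integral>\<^sup>+u. ennreal (indicator {0..} u * u powr (a - 1) / exp u) \<partial>lborel)"
    by (intro nn_integral_cong) (auto simp: indicator_def exp_minus divide_inverse)
  also have "\<dots> = ennreal (Gamma a)"
    using Gamma_conv_nn_integral_real[OF assms] by simp
  finally show "(\<integral>\<^sup>+u. ennreal (u powr (a - 1) * exp (- u)) \<partial>restrict_space lborel {0<..}) = ennreal (Gamma a)" .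
qed (use assms in \<open>simp_all add: Gamma_real_pos less_imp_le\<close>)

text \<open>When \<open>x\<close> is a positive integer this is the image of Lebesgue measure on
  x-dimensional Euclidean space under the squared norm.\<close>

definition radial_measure :: "real \<Rightarrow> real measure" where
  "radial_measure x = density (restrict_space lborel {0<..})
     (\<lambda>u. ennreal (pi powr (x / 2) / Gamma (x / 2) * u powr (x / 2 - 1)))"

text \<open>The quotient of the normalising constants \<open>pi powr (y / 2) / Gamma (y / 2)\<close>
  at \<open>y = x + 2 * r\<close> and at \<open>y = x\<close>.\<close>

definition shift_ratio :: "real \<Rightarrow> real \<Rightarrow> real" where
  "shift_ratio x r = pi powr r * (Gamma (x / 2) / Gamma (x / 2 + r))"

lemma shift_ratio_pos: "0 < x \<Longrightarrow> 0 \<le> r \<Longrightarrow> 0 < shift_ratio x r"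
  by (simp add: shift_ratio_def Gamma_real_pos)

lemma shift_ratio_0:
  assumes "0 < x"
  shows "shift_ratio x 0 = 1"
proof -
  have "0 < Gamma (x / 2)" using assms by (simp add: Gamma_real_pos)
  then show ?thesis by (simp add: shift_ratio_def)
qed

text \<open>A product of successive quotients telescopes. This cocycle identity is what makes the
  candidate functor respect composition.\<close>

lemma shift_ratio_add:
  assumes "0 < x" "0 \<le> r" "0 \<le> s"
  shows "shift_ratio (x + 2 * r) s * shift_ratio x r = shift_ratio x (r + s)"
proof -
  have "0 < Gamma (x / 2 + r)" using assms by (simp add: Gamma_real_pos)
  then show ?thesis by (simp add: shift_ratio_def add_divide_distrib powr_add add.assoc)
qed

lemma sets_radial_measure: "sets (radial_measure x) = sets (restrict_space borel {0<..})"
  by (simp add: radial_measure_def sets_restrict_space)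

lemma borel_measurable_radial_measure:
  "f \<in> borel_measurable borel \<Longrightarrow> f \<in> borel_measurable (radial_measure x)"
  unfolding measurable_cong_sets[OF sets_radial_measure refl] by (rule measurable_restrict_space1)

lemma space_radial_measure: "space (radial_measure x) = {0<..}"
  by (simp add: radial_measure_def space_restrict_space)

text \<open>The factor \<open>u powr r\<close> shifts the exponent in Euler's integral to
  \<open>x / 2 + r - 1\<close>. The case \<open>r = 0\<close> gives the normalization; general
  \<open>r\<close> later determines the constants of the morphisms.\<close>

lemma has_bochner_integral_radial_measure_exp:
  assumes x: "0 < x" and r: "0 \<le> r"
  shows "has_bochner_integral (radial_measure x) (\<lambda>u. u powr r * exp (- u))
    (pi powr (x / 2) / Gamma (x / 2) * Gamma (x / 2 + r))"
  unfolding radial_measure_def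
proof (rule has_bochner_integral_density)
  let ?M = "restrict_space lborel {0<..} :: real measure"
  have "has_bochner_integral ?M
      (\<lambda>u. pi powr (x / 2) / Gamma (x / 2) * (u powr (x / 2 + r - 1) * exp (- u)))
      (pi powr (x / 2) / Gamma (x / 2) * Gamma (x / 2 + r))"
    using x r by (intro has_bochner_integral_mult_right has_bochner_integral_Gamma) simp
  then show "has_bochner_integral ?M
      (\<lambda>u. (pi powr (x / 2) / Gamma (x / 2) * u powr (x / 2 - 1)) *\<^sub>R (u powr r * exp (- u)))
      (pi powr (x / 2) / Gamma (x / 2) * Gamma (x / 2 + r))"
  proof (rule has_bochner_integral_cong[THEN iffD1, rotated -1])
    fix u :: real
    have "u powr (x / 2 + r - 1) = u powr (x / 2 - 1) * u powr r"
      by (simp add: powr_add[symmetric] algebra_simps)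
    then show "pi powr (x / 2) / Gamma (x / 2) * (u powr (x / 2 + r - 1) * exp (- u))
        = (pi powr (x / 2) / Gamma (x / 2) * u powr (x / 2 - 1)) *\<^sub>R (u powr r * exp (- u))"
      by simp
  qed simp_all
  show "AE u in ?M. 0 \<le> pi powr (x / 2) / Gamma (x / 2) * u powr (x / 2 - 1)"
    using x by (simp add: Gamma_real_pos less_imp_le)
qed (rule measurable_restrict_space1, measurable)+

lemma radial_measure_gaussian:
  assumes "0 < x"
  shows "integrable (radial_measure x) (\<lambda>u. exp (- u))"
    and "(\<integral>u. exp (- u) \<partial>radial_measure x) = pi powr (x / 2)"
proof -
  have "0 < Gamma (x / 2)" using assms by (simp add: Gamma_real_pos)
  then have "has_bochner_integral (radial_measure x) (\<lambda>u. u powr 0 * exp (- u)) (pi powr (x / 2))"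
    using has_bochner_integral_radial_measure_exp[OF assms, of 0] by simp
  \<comment> \<open>As \<open>0 powr 0 = 0\<close>, dropping \<open>u powr 0\<close> relies on the
    space of the measure containing only positive \<open>u\<close>.\<close>
  then have "has_bochner_integral (radial_measure x) (\<lambda>u. exp (- u)) (pi powr (x / 2))"
    by (rule has_bochner_integral_cong[THEN iffD1, rotated -1]) (auto simp: space_radial_measure)
  then show "integrable (radial_measure x) (\<lambda>u. exp (- u))"
    "(\<integral>u. exp (- u) \<partial>radial_measure x) = pi powr (x / 2)"
    by (auto simp: has_bochner_integral_iff)
qed

text \<open>Substituting \<open>c * u\<close> for \<open>u\<close> contributes \<open>c\<close> from
  Lebesgue measure and \<open>c powr (x / 2 - 1)\<close> from the density, together
  \<open>c powr (x / 2)\<close>.\<close>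

lemma radial_measure_scaling:
  assumes x: "0 < x" and \<phi>: "\<phi> \<in> Cc_pos" and c: "0 < c"
  shows "(\<integral>u. \<phi> (c * u) \<partial>radial_measure x) = c powr (- x / 2) * (\<integral>u. \<phi> u \<partial>radial_measure x)"
proof -
  define C where "C = pi powr (x / 2) / Gamma (x / 2)"
  have C: "0 \<le> C" using x by (simp add: C_def Gamma_real_pos less_imp_le)
  have cont: "continuous_on {0<..} \<phi>" using \<phi> by (simp add: Cc_pos_def)
  \<comment> \<open>The integral is moved to \<open>lborel\<close> with an indicator, where the
    affine substitution is available. It is needed both for \<phi> and for its rescaling.\<close>
  have int: "(\<integral>u. \<psi> u \<partial>radial_measure x)
      = (\<integral>u. indicator {0<..} u *\<^sub>R ((C * u powr (x / 2 - 1)) *\<^sub>R \<psi> u) \<partial>lborel)"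
    if "continuous_on {0<..} \<psi>" for \<psi> :: "real \<Rightarrow> real"
  proof -
    have "\<psi> \<in> borel_measurable (restrict_space lborel {0<..})"
      using borel_measurable_continuous_on_restrict[OF that]
      by (subst measurable_cong_sets[of _ "restrict_space borel {0<..}" _ borel])
         (simp_all add: sets_restrict_space)
    moreover have "(\<lambda>u. C * u powr (x / 2 - 1)) \<in> borel_measurable (restrict_space lborel {0<..})"
      by (rule measurable_restrict_space1) measurable
    ultimately have "(\<integral>u. \<psi> u \<partial>radial_measure x)
        = (\<integral>u. (C * u powr (x / 2 - 1)) *\<^sub>R \<psi> u \<partial>restrict_space lborel {0<..})"
      unfolding radial_measure_def C_def[symmetric] using C
      by (intro integral_density) simp_all
    then show ?thesis by (simp add: integral_restrict_space)
  qed
  have "(\<integral>u. \<phi> u \<partial>radial_measure x)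
      = (\<integral>u. indicator {0<..} u *\<^sub>R ((C * u powr (x / 2 - 1)) *\<^sub>R \<phi> u) \<partial>lborel)"
    by (rule int[OF cont])
  also have "\<dots> = \<bar>c\<bar> *\<^sub>R (\<integral>u. indicator {0<..} (0 + c * u) *\<^sub>R
      ((C * (0 + c * u) powr (x / 2 - 1)) *\<^sub>R \<phi> (0 + c * u)) \<partial>lborel)"
    using c by (intro lborel_integral_real_affine) simp
  also have "\<dots> = c * (\<integral>u. c powr (x / 2 - 1) *
      (indicator {0<..} u *\<^sub>R ((C * u powr (x / 2 - 1)) *\<^sub>R \<phi> (c * u))) \<partial>lborel)"
    using c by (auto simp: indicator_def powr_mult zero_less_mult_iff mult_ac
        intro!: Bochner_Integration.integral_cong)
  also have "\<dots> = c powr (x / 2) * (\<integral>u. \<phi> (c * u) \<partial>radial_measure x)"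
  proof -
    have "continuous_on {0<..} (\<lambda>u. \<phi> (c * u))"
      using c by (intro continuous_on_compose2[OF cont]) (auto intro!: continuous_intros)
    moreover have "c * c powr (x / 2 - 1) = c powr (x / 2)"
      using c by (simp add: powr_diff)
    ultimately show ?thesis
      by (subst int) (simp_all only: integral_mult_right_zero mult.assoc[symmetric, of c])
  qed
  finally have eq: "(\<integral>u. \<phi> u \<partial>radial_measure x) = c powr (x / 2) * (\<integral>u. \<phi> (c * u) \<partial>radial_measure x)" .
  have inv: "c powr (- x / 2) * c powr (x / 2) = 1"
    using c by (simp add: powr_add[symmetric])
  show ?thesis unfolding eq mult.assoc[symmetric] inv by simp
qed

lemma density_radial_measure:
  assumes x: "0 < x" and r: "0 \<le> r"
  shows "density (radial_measure x) (\<lambda>u. ennreal (shift_ratio x r * u powr r)) = radial_measure (x + 2 * r)"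
proof -
  have pos: "0 < Gamma (x / 2)" "0 < Gamma (x / 2 + r)" using x r by (simp_all add: Gamma_real_pos)
  have "density (radial_measure x) (\<lambda>u. ennreal (shift_ratio x r * u powr r))
      = density (restrict_space lborel {0<..})
          (\<lambda>u. ennreal (pi powr (x / 2) / Gamma (x / 2) * u powr (x / 2 - 1)) *
               ennreal (shift_ratio x r * u powr r))"
    unfolding radial_measure_def
    by (intro density_density_eq) (rule measurable_restrict_space1, measurable)+
  also have "\<dots> = radial_measure (x + 2 * r)"
    unfolding radial_measure_def
  proof (intro density_cong AE_I2)
    fix u :: real assume "u \<in> space (restrict_space lborel {0<..})"
    then have u: "0 < u" by (simp add: space_restrict_space)
    have "u powr (x / 2 + r - 1) = u powr (x / 2 - 1) * u powr r"
      by (simp add: powr_add[symmetric] algebra_simps)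
    then show "ennreal (pi powr (x / 2) / Gamma (x / 2) * u powr (x / 2 - 1)) *
          ennreal (shift_ratio x r * u powr r)
        = ennreal (pi powr ((x + 2 * r) / 2) / Gamma ((x + 2 * r) / 2) * u powr ((x + 2 * r) / 2 - 1))"
      using pos by (simp add: ennreal_mult[symmetric] shift_ratio_def add_divide_distrib powr_add)
  qed (rule measurable_restrict_space1, measurable)+
  finally show ?thesis .
qed

lemma shift_ratio_densities:
  assumes "0 < x" "0 \<le> r"
  shows "(\<lambda>u. shift_ratio x r * u powr r) \<in> densities (radial_measure x) (radial_measure (x + 2 * r))"
  using density_radial_measure[OF assms] shift_ratio_pos[OF assms]
  by (auto simp: densities_def intro!: borel_measurable_radial_measure)

lemma radon_pos_radial_measure:
  assumes "0 < x"
  shows "radon_pos (radial_measure x)"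
proof -
  have fin: "emeasure (radial_measure x) {0<..<t} < \<infinity>" for t
    using integrable_exp_emeasure_Ioo_finite sets_radial_measure radial_measure_gaussian(1)[OF assms] .
  \<comment> \<open>As the mass near 0 is finite, \<open>{0<..<u + 1}\<close> can serve as the
    neighbourhood of \<open>u\<close>.\<close>
  have "\<exists>U. open U \<and> u \<in> U \<and> U \<subseteq> {0<..} \<and> emeasure (radial_measure x) U < \<infinity>" if "0 < u" for u
    using fin[of "u + 1"] that by (intro exI[of _ "{0<..<u + 1}"]) auto
  then show ?thesis
    unfolding radon_pos_def
    using inner_regular_pos[OF sets_radial_measure fin] sets_radial_measure by blast
qed

text \<open>If the measure were zero, its Gaussian integral would vanish, whereas it equals
  \<open>pi powr (x / 2)\<close>.\<close>

lemma radial_measure_Obj: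
  assumes "0 < x"
  shows "radial_measure x \<in> Obj RadMeas"
proof -
  have "emeasure (radial_measure x) {0<..} \<noteq> 0"
  proof
    assume "emeasure (radial_measure x) {0<..} = 0"
    then have "{0<..} \<in> null_sets (radial_measure x)"
      using sets.top[of "radial_measure x"] by (simp add: null_sets_def space_radial_measure)
    then have "AE u in radial_measure x. u \<notin> {0<..}" by (rule AE_not_in)
    then have "AE u in radial_measure x. exp (- u) = (0 :: real)"
      using AE_space by eventually_elim (simp add: space_radial_measure)
    then have "(\<integral>u. exp (- u) \<partial>radial_measure x) = (0 :: real)"
      by (rule integral_eq_zero_AE)
    then show False using radial_measure_gaussian(2)[OF assms] by simp
  qed
  then show ?thesis using radon_pos_radial_measure[OF assms] by (simp add: RadMeas_def)
qed

section \<open>Morphisms as classes, and the candidate functor\<close>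

lemma dens_mor_cong:
  assumes "f \<in> densities \<mu> \<nu>" "g \<in> densities \<mu> \<nu>" "AE u in \<mu>. f u = g u"
  shows "dens_mor \<mu> \<nu> f = dens_mor \<mu> \<nu> g"
  unfolding dens_mor_def using assms
  by (intro equiv_class_eq[OF equiv_ae_eq]) (simp add: ae_eq_def)

text \<open>Members of the hom-set are nonempty classes, while \<open>dens_mor\<close> of a function
  that is not a density is empty. This recovers a true density from an equation between
  classes.\<close>

lemma dens_mor_in_HomD:
  assumes "dens_mor \<mu> \<nu> f \<in> Hom RadMeas \<mu> \<nu>"
  shows "f \<in> densities \<mu> \<nu>"
proof -
  obtain g where "g \<in> densities \<mu> \<nu>" "dens_mor \<mu> \<nu> f = dens_mor \<mu> \<nu> g"
    using assms by (auto simp: Hom_RadMeas)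
  then have "g \<in> dens_mor \<mu> \<nu> f"
    using equiv_class_self[OF equiv_ae_eq] by (simp add: dens_mor_def)
  then show ?thesis by (simp add: dens_mor_def ae_eq_def)
qed

text \<open>The value \<open>undefined\<close> off objects and arrows is the one that
  \<open>is_functor\<close> prescribes.\<close>

definition radial_functor :: dim_functor where
  "radial_functor =
     \<lparr> on_obj = (\<lambda>x. if 0 < x then radial_measure x else undefined),
       on_arr = (\<lambda>x y r. if 0 < x \<and> 0 \<le> r \<and> y = x + 2 * r
         then dens_mor (radial_measure x) (radial_measure y) (\<lambda>u. shift_ratio x r * u powr r)
         else undefined) \<rparr>"

lemma radial_functor_is_functor: "is_functor Dim_plus RadMeas radial_functor"
  unfolding is_functor_def
proof (intro conjI ballI allI impI)
  fix x assume "x \<in> Obj Dim_plus"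
  then have x: "0 < x" by (simp add: Dim_plus_def)
  show "on_obj radial_functor x \<in> Obj RadMeas"
    using x radial_measure_Obj by (simp add: radial_functor_def)
  \<comment> \<open>The two representatives differ at 0, where \<open>u powr 0\<close> is 0, so the
    classes are compared by almost everywhere equality on the half-line.\<close>
  have "dens_mor (radial_measure x) (radial_measure x) (\<lambda>u. shift_ratio x 0 * u powr 0)
      = dens_mor (radial_measure x) (radial_measure x) (\<lambda>_. 1)"
    using shift_ratio_densities[OF x, of 0]
    by (intro dens_mor_cong one_densities) (auto simp: x shift_ratio_0 space_radial_measure)
  then show "on_arr radial_functor x x (Ident Dim_plus x) = Ident RadMeas (on_obj radial_functor x)"
    using x by (simp add: radial_functor_def Dim_plus_def RadMeas_def)
next
  fix x y r assume "x \<in> Obj Dim_plus" "y \<in> Obj Dim_plus" "r \<in> Hom Dim_plus x y"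
  then have x: "0 < x" "0 \<le> r" "y = x + 2 * r" by (simp_all add: Dim_plus_def)
  then show "on_arr radial_functor x y r \<in> Hom RadMeas (on_obj radial_functor x) (on_obj radial_functor y)"
    using shift_ratio_densities[OF x(1,2)] by (simp add: radial_functor_def Hom_RadMeas)
next
  fix x y z r s assume "x \<in> Obj Dim_plus" "y \<in> Obj Dim_plus" "z \<in> Obj Dim_plus"
    "r \<in> Hom Dim_plus x y" "s \<in> Hom Dim_plus y z"
  then have x: "0 < x" "0 < y" "0 < z" "0 \<le> r" "0 \<le> s" "y = x + 2 * r" "z = y + 2 * s"
    by (simp_all add: Dim_plus_def)
  have z: "z = x + 2 * (r + s)" using x by simp
  have r: "(\<lambda>u. shift_ratio x r * u powr r) \<in> densities (radial_measure x) (radial_measure y)"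
    and s: "(\<lambda>u. shift_ratio y s * u powr s) \<in> densities (radial_measure y) (radial_measure z)"
    and rs: "(\<lambda>u. shift_ratio x (r + s) * u powr (r + s)) \<in> densities (radial_measure x) (radial_measure z)"
    using shift_ratio_densities[OF x(1,4)] shift_ratio_densities[OF x(2,5)]
      shift_ratio_densities[OF x(1) add_nonneg_nonneg[OF x(4,5)]]
    unfolding x(6)[symmetric] x(7)[symmetric] z[symmetric] by simp_all
  \<comment> \<open>The representatives agree as functions, by the cocycle identity and addition of
    exponents, so the classes coincide.\<close>
  have "shift_ratio y s * u powr s * (shift_ratio x r * u powr r)
      = shift_ratio x (r + s) * u powr (r + s)" for u
    using shift_ratio_add[of x r s] x by (simp add: powr_add mult_ac)
  then have "Comp RadMeas (radial_measure x) (radial_measure y) (radial_measure z)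
        (dens_mor (radial_measure y) (radial_measure z) (\<lambda>u. shift_ratio y s * u powr s))
        (dens_mor (radial_measure x) (radial_measure y) (\<lambda>u. shift_ratio x r * u powr r))
      = dens_mor (radial_measure x) (radial_measure z) (\<lambda>u. shift_ratio x (r + s) * u powr (r + s))"
    by (simp add: Comp_dens_mor[OF radon_pos_radial_measure[OF x(1)] r s])
  moreover have "on_arr radial_functor x z (r + s)
      = dens_mor (radial_measure x) (radial_measure z) (\<lambda>u. shift_ratio x (r + s) * u powr (r + s))"
    using x(1,4,5) z by (simp add: radial_functor_def)
  moreover have "on_arr radial_functor x y r
      = dens_mor (radial_measure x) (radial_measure y) (\<lambda>u. shift_ratio x r * u powr r)"
    using x(1,4,6) by (simp add: radial_functor_def)
  moreover have "on_arr radial_functor y z s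
      = dens_mor (radial_measure y) (radial_measure z) (\<lambda>u. shift_ratio y s * u powr s)"
    using x(2,5,7) by (simp add: radial_functor_def)
  moreover have "on_obj radial_functor x = radial_measure x" "on_obj radial_functor y = radial_measure y"
      "on_obj radial_functor z = radial_measure z"
    using x(1-3) by (simp_all add: radial_functor_def)
  moreover have "Comp Dim_plus x y z s r = r + s"
    by (simp add: Dim_plus_def)
  ultimately show "on_arr radial_functor x z (Comp Dim_plus x y z s r)
      = Comp RadMeas (on_obj radial_functor x) (on_obj radial_functor y) (on_obj radial_functor z)
          (on_arr radial_functor y z s) (on_arr radial_functor x y r)"
    by simp
qed (use is_category_Dim_plus is_category_RadMeas in \<open>auto simp: radial_functor_def Dim_plus_def\<close>)

lemma radial_functor_sc_gaussian:
  "sc_homogeneous_functor radial_functor" "gaussian_normalized radial_functor"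
proof -
  have "scaling_covariant radial_functor"
    using radial_measure_scaling by (simp add: scaling_covariant_def radial_functor_def)
  moreover have "homogeneous_densities radial_functor"
    unfolding homogeneous_densities_def
    by (rule exI[of _ shift_ratio]) (simp add: radial_functor_def shift_ratio_pos)
  ultimately show "sc_homogeneous_functor radial_functor"
    using radial_functor_is_functor by (simp add: sc_homogeneous_functor_def)
  show "gaussian_normalized radial_functor"
    using radial_measure_gaussian by (simp add: gaussian_normalized_def radial_functor_def)
qed

section \<open>Uniqueness of the functor\<close>

text \<open>Both measures scale with exponent \<open>x / 2\<close> and share the nonzero Gaussian
  integral \<open>pi powr (x / 2)\<close>.\<close>

lemma on_obj_eq_radial_measure:
  assumes M: "sc_homogeneous_functor M" "gaussian_normalized M" and x: "0 < x"
  shows "on_obj M x = radial_measure x"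
proof (rule scaling_measure_unique)
  have "on_obj M x \<in> Obj RadMeas"
    using M(1) x by (auto simp: sc_homogeneous_functor_def is_functor_def Dim_plus_def)
  then show "sets (on_obj M x) = sets (restrict_space borel {0<..})"
    by (simp add: RadMeas_def radon_pos_def)
  show "(\<integral>u. \<phi> (c * u) \<partial>on_obj M x) = c powr - (x / 2) * (\<integral>u. \<phi> u \<partial>on_obj M x)"
    if "\<phi> \<in> Cc_pos" "0 < c" for \<phi> c
    using M(1) x that by (simp add: sc_homogeneous_functor_def scaling_covariant_def)
  show "(\<integral>u. \<phi> (c * u) \<partial>radial_measure x) = c powr - (x / 2) * (\<integral>u. \<phi> u \<partial>radial_measure x)"
    if "\<phi> \<in> Cc_pos" "0 < c" for \<phi> c
    using radial_measure_scaling[OF x that] by simp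
qed (use M(2) x radial_measure_gaussian[OF x] sets_radial_measure in
      \<open>simp_all add: gaussian_normalized_def\<close>)

lemma on_arr_eq_shift_ratio:
  assumes M: "sc_homogeneous_functor M" "gaussian_normalized M" and x: "0 < x" and r: "0 \<le> r"
  shows "on_arr M x (x + 2 * r) r =
    dens_mor (radial_measure x) (radial_measure (x + 2 * r)) (\<lambda>u. shift_ratio x r * u powr r)"
proof -
  have y: "0 < x + 2 * r" using x r by simp
  obtain a where a: "0 < a" and arr: "on_arr M x (x + 2 * r) r =
      dens_mor (radial_measure x) (radial_measure (x + 2 * r)) (\<lambda>u. a * u powr r)"
    using M(1) x r on_obj_eq_radial_measure[OF M x] on_obj_eq_radial_measure[OF M y]
    by (fastforce simp: sc_homogeneous_functor_def homogeneous_densities_def)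
  have "x \<in> Obj Dim_plus" "x + 2 * r \<in> Obj Dim_plus" "r \<in> Hom Dim_plus x (x + 2 * r)"
    using x r y by (simp_all add: Dim_plus_def)
  \<comment> \<open>Homogeneity only equates the arrow with \<open>dens_mor\<close> of a power
    function; functoriality puts it in the hom-set, so that function is a density.\<close>
  then have "on_arr M x (x + 2 * r) r \<in> Hom RadMeas (on_obj M x) (on_obj M (x + 2 * r))"
    using M(1) unfolding sc_homogeneous_functor_def is_functor_def by blast
  then have "(\<lambda>u. a * u powr r) \<in> densities (radial_measure x) (radial_measure (x + 2 * r))"
    using arr on_obj_eq_radial_measure[OF M x] on_obj_eq_radial_measure[OF M y]
    by (simp add: dens_mor_in_HomD)
  then have dens: "radial_measure (x + 2 * r) = density (radial_measure x) (\<lambda>u. ennreal (a * u powr r))"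
    by (simp add: densities_def)
  \<comment> \<open>The target's Gaussian integral is evaluated twice: by its normalization, and as
    a Gamma integral against the source. Comparison isolates \<open>a\<close>.\<close>
  have "pi powr (x / 2 + r) = (\<integral>u. exp (- u) \<partial>radial_measure (x + 2 * r))"
    using radial_measure_gaussian(2)[OF y] by (simp add: add_divide_distrib)
  also have "\<dots> = (\<integral>u. a * (u powr r * exp (- u)) \<partial>radial_measure x)"
    unfolding dens using a
    by (subst integral_density) (auto intro!: borel_measurable_radial_measure simp: mult.assoc)
  also have "\<dots> = a * (pi powr (x / 2) / Gamma (x / 2) * Gamma (x / 2 + r))"
    using has_bochner_integral_radial_measure_exp[OF x r]
    by (simp add: has_bochner_integral_iff)
  finally have "pi powr (x / 2) * pi powr r = pi powr (x / 2) * (a * (Gamma (x / 2 + r) / Gamma (x / 2)))"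
    by (simp add: powr_add)
  then have "pi powr r = a * (Gamma (x / 2 + r) / Gamma (x / 2))"
    by (subst (asm) mult_left_cancel) simp_all
  moreover have "0 < Gamma (x / 2)" "0 < Gamma (x / 2 + r)"
    using x r by (simp_all add: Gamma_real_pos)
  ultimately have "a = shift_ratio x r"
    by (simp add: shift_ratio_def)
  then show ?thesis using arr by simp
qed

text \<open>Agreement on objects and arrows becomes equality of records because both functors are
  \<open>undefined\<close> elsewhere.\<close>

lemma eq_radial_functor:
  assumes M: "sc_homogeneous_functor M" "gaussian_normalized M"
  shows "M = radial_functor"
proof (rule cat_map.equality)
  have undef: "\<And>x. \<not> 0 < x \<Longrightarrow> on_obj M x = undefined"
    "\<And>x y r. \<not> (0 < x \<and> 0 < y \<and> 0 \<le> r \<and> y = x + 2 * r) \<Longrightarrow> on_arr M x y r = undefined"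
    using M(1) by (auto simp: sc_homogeneous_functor_def is_functor_def Dim_plus_def)
  show "on_obj M = on_obj radial_functor"
    using on_obj_eq_radial_measure[OF M] undef(1) by (auto simp: radial_functor_def)
  show "on_arr M = on_arr radial_functor"
  proof (intro ext)
    fix x y r
    show "on_arr M x y r = on_arr radial_functor x y r"
    proof (cases "0 < x \<and> 0 \<le> r \<and> y = x + 2 * r")
      case True
      then show ?thesis using on_arr_eq_shift_ratio[OF M, of x r] by (simp add: radial_functor_def)
    next
      case False
      then show ?thesis using undef(2)[of x y r] by (auto simp: radial_functor_def)
    qed
  qed
qed simp

theorem theorem5p2:
  shows "(\<exists>!M. sc_homogeneous_functor M \<and> gaussian_normalized M) \<and>
    (\<forall>M. sc_homogeneous_functor M \<and> gaussian_normalized M \<longrightarrow>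
      (\<forall>x>0. on_obj M x =
         density (restrict_space lborel {0<..})
           (\<lambda>u. ennreal (pi powr (x / 2) / Gamma (x / 2) * u powr (x / 2 - 1)))) \<and>
      (\<forall>x>0. \<forall>r\<ge>0. on_arr M x (x + 2 * r) r =
         dens_mor (on_obj M x) (on_obj M (x + 2 * r))
           (\<lambda>u. pi powr r * (Gamma (x / 2) / Gamma (x / 2 + r)) * u powr r)))"
proof (intro conjI allI impI)
  show "\<exists>!M. sc_homogeneous_functor M \<and> gaussian_normalized M"
    using radial_functor_sc_gaussian eq_radial_functor by blast
next
  fix M :: dim_functor and x :: real
  assume M: "sc_homogeneous_functor M \<and> gaussian_normalized M" and x: "0 < x"
  then show "on_obj M x = density (restrict_space lborel {0<..})
      (\<lambda>u. ennreal (pi powr (x / 2) / Gamma (x / 2) * u powr (x / 2 - 1)))"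
    using on_obj_eq_radial_measure by (simp add: radial_measure_def)
  fix r :: real assume "0 \<le> r"
  then show "on_arr M x (x + 2 * r) r = dens_mor (on_obj M x) (on_obj M (x + 2 * r))
      (\<lambda>u. pi powr r * (Gamma (x / 2) / Gamma (x / 2 + r)) * u powr r)"
    using on_arr_eq_shift_ratio[of M x r] on_obj_eq_radial_measure[of M] M x
    by (simp add: shift_ratio_def)
qed

end
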